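(* Let $\mathcal{I}=\{(i\mid A_i): i\in[m]\}$ be an index coding instance. Then $\beta(\mathcal{I})\le\beta_{\text{FP-UMCD}}(\mathcal{I})$, where $$\beta_{\text{FP-UMCD}}(\mathcal{I})=\min\sum_{j\in[n]}\gamma_j\,\beta_{\text{UMCD}}(M_j),$$ the minimum being over all finite families of (possibly overlapping) subsets $M_1,\dots,M_n\subseteq[m]$ and weights $\gamma_j\in[0,1]$ such that $\sum_{j:\, i\in M_j}\gamma_j\ge1$ for every $i\in[m]$.
   Context: Index coding: messages $x_i\in\mathbb{F}_q^t$, $i\in[m]$; receiver $i$ wants $x_i$ and knows $\{x_j:j\in A_i\}$, $A_i\subseteq[m]\setminus\{i\}$. A $(t,r)$ index code is an encoder $\phi:\mathbb{F}_q^{mt}\to\mathbb{F}_q^r$ with decoders $\psi_i$ such that $\psi_i(\phi(x),(x_j)_{j\in A_i})=x_i$ for all messages and receivers; $\beta(\mathcal{I})$ is the infimum of $r/t$ over all $t$ and all $(t,r)$ index codes (over finite fields). The subinstance $M\subseteq[m]$ has receivers $M$ and side information $A_i\cap M$; $B_i$ is the complement of $A_i\cup\{i\}$ within the receiver set. For a $0/1$ matrix $\boldsymbol{G}$, $\boldsymbol{G}^L_{[k]}$ is the submatrix of the first $k$ rows and columns $L$; $\mathrm{mcm}$ is the maximum number of $1$-entries in distinct rows and columns (0 for no columns). UMCD algorithm: $N=$ all receivers, $k=0$; while $N\ne\emptyset$: $k\leftarrow k+1$; pick $w\in N$ minimizing $|A_w|$ (arbitrary tie-breaking); row $k$ of $\boldsymbol{G}$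 is the indicator of $\{w\}\cup A_w$; remove $w$ from $N$; remove every $i\in N$ with $\mathrm{mcm}(\boldsymbol{G}_{[k]}^{\{i\}\cup B_i})=\mathrm{mcm}(\boldsymbol{G}_{[k]}^{B_i})+1$; output $k$. $\beta_{\text{UMCD}}(M)$ is the output of (a fixed execution of) this algorithm on subinstance $M$. *)

theory Defs
  imports Complex_Main "HOL-Computational_Algebra.Primes"
begin

text \<open>Receivers/messages are indexed by 0..<m (standing for [m]).  Since encoders and
decoders are arbitrary functions, an index code over F_q depends only on the alphabet
size q; we model F_q by the alphabet {0..<q} with q a prime power.\<close>

definition is_prime_power :: "nat \<Rightarrow> bool" where
  "is_prime_power q \<longleftrightarrow> (\<exists>p k. prime p \<and> k > 0 \<and> q = p ^ k)"

definition vecs :: "nat \<Rightarrow> nat \<Rightarrow> (nat \<Rightarrow> nat) set" where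
  "vecs q t = {v. \<forall>k. (k < t \<longrightarrow> v k < q) \<and> (t \<le> k \<longrightarrow> v k = 0)}"

definition msgs :: "nat \<Rightarrow> nat \<Rightarrow> nat \<Rightarrow> (nat \<Rightarrow> nat \<Rightarrow> nat) set" where
  "msgs q m t = {x. (\<forall>i<m. x i \<in> vecs q t) \<and> (\<forall>i. m \<le> i \<longrightarrow> x i = (\<lambda>_. 0))}"

definition side_info :: "(nat \<Rightarrow> nat set) \<Rightarrow> nat \<Rightarrow> (nat \<Rightarrow> nat \<Rightarrow> nat) \<Rightarrow> (nat \<Rightarrow> nat \<Rightarrow> nat)" where
  "side_info A i x = (\<lambda>j. if j \<in> A i then x j else (\<lambda>_. 0))"

definition is_index_code ::
  "nat \<Rightarrow> nat \<Rightarrow> (nat \<Rightarrow> nat set) \<Rightarrow> nat \<Rightarrow> nat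
   \<Rightarrow> ((nat \<Rightarrow> nat \<Rightarrow> nat) \<Rightarrow> (nat \<Rightarrow> nat))
   \<Rightarrow> (nat \<Rightarrow> (nat \<Rightarrow> nat) \<Rightarrow> (nat \<Rightarrow> nat \<Rightarrow> nat) \<Rightarrow> (nat \<Rightarrow> nat)) \<Rightarrow> bool" where
  "is_index_code q m A t r \<phi> \<psi> \<longleftrightarrow>
     (\<forall>x\<in>msgs q m t. \<phi> x \<in> vecs q r \<and> (\<forall>i<m. \<psi> i (\<phi> x) (side_info A i x) = x i))"

definition beta :: "nat \<Rightarrow> (nat \<Rightarrow> nat set) \<Rightarrow> real" where
  "beta m A = Inf {real r / real t | q t r. is_prime_power q \<and> t > 0 \<and>
                    (\<exists>\<phi> \<psi>. is_index_code q m A t r \<phi> \<psi>)}"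

text \<open>A 0/1 matrix with rows given as a list: row a is the set of columns holding a 1.
  mcm G L: maximum number of 1-entries of the submatrix with columns L, no two in the
  same row or column (0 if there are no columns).\<close>
definition mcm :: "nat set list \<Rightarrow> nat set \<Rightarrow> nat" where
  "mcm G L = Max {card S | S. S \<subseteq> {(a, c). a < length G \<and> c \<in> L \<and> c \<in> G ! a}
                              \<and> inj_on fst S \<and> inj_on snd S}"

definition Bset :: "nat set \<Rightarrow> (nat \<Rightarrow> nat set) \<Rightarrow> nat \<Rightarrow> nat set" where
  "Bset M A i = M - ((A i \<inter> M) \<union> {i})"

text \<open>Executions of the UMCD algorithm on subinstance M (any tie-breaking).
  umcd_exec M A N G k: from the state with remaining set N and rows G so far, some
  execution terminates with output k (= number of rows built).\<close>
inductive umcd_exec :: "nat set \<Rightarrow> (nat \<Rightarrow> nat set) \<Rightarrow> nat set \<Rightarrow> nat set list \<Rightarrow> nat \<Rightarrow> bool"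
  for M :: "nat set" and A :: "nat \<Rightarrow> nat set" where
  stop: "umcd_exec M A {} G (length G)"
| step: "\<lbrakk> w \<in> N; \<forall>v\<in>N. card (A w \<inter> M) \<le> card (A v \<inter> M);
          G' = G @ [{w} \<union> (A w \<inter> M)];
          N' = {i \<in> N - {w}. mcm G' ({i} \<union> Bset M A i) \<noteq> mcm G' (Bset M A i) + 1};
          umcd_exec M A N' G' k \<rbrakk> \<Longrightarrow> umcd_exec M A N G k"

definition beta_FP_UMCD :: "nat \<Rightarrow> (nat \<Rightarrow> nat set) \<Rightarrow> real" where
  "beta_FP_UMCD m A = Inf {(\<Sum>j<n. \<gamma> j * real (k j)) | (n::nat) (Ms::nat \<Rightarrow> nat set) (\<gamma>::nat \<Rightarrow> real) (k::nat \<Rightarrow> nat).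
      (\<forall>j<n. Ms j \<subseteq> {..<m} \<and> 0 \<le> \<gamma> j \<and> \<gamma> j \<le> 1 \<and> umcd_exec (Ms j) A (Ms j) [] (k j))
    \<and> (\<forall>i<m. (\<Sum>j | j < n \<and> i \<in> Ms j. \<gamma> j) \<ge> 1)}"

end

theory Submission
  imports Defs "HOL-Library.Nat_Bijection" "Jordan_Normal_Form.Determinant"
begin

text \<open>
  Fill the 1-entries of the matrix built by UMCD with distinct numbers of the form
  \<open>2 ^ 2 ^ e\<close>.  The Leibniz terms of a square submatrix are then signed, pairwise distinct powers
  of two, so its determinant vanishes only if no term survives, i.e. if it has no perfect matching.
  When \<open>mcm\<close> grows by adding column \<open>i\<close> to \<open>B\<^sub>i\<close>, take a maximum matching;
  it uses column \<open>i\<close>, and the cofactors along that column give a row combination that vanishes on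
  \<open>B\<^sub>i\<close> (replacing column \<open>i\<close> by one of \<open>B\<^sub>i\<close> yields a repeated column or a
  submatrix without perfect matching) and is a nonzero integer at \<open>i\<close>.  Modulo a large prime
  this lets receiver \<open>i\<close> decode.  Time sharing the resulting scalar codes, the \<open>j\<close>-th one being
  used \<open>\<lceil>\<gamma>\<^sub>j t\<rceil>\<close> times, and letting \<open>t\<close> tend to infinity gives the bound.
\<close>

section \<open>Matchings and generic determinants\<close>

text \<open>The term with the least exponent cannot be cancelled: every other exponent is strictly
  larger, so the remaining terms are divisible by a higher power of two than this one.\<close>

lemma signed_powers_of_two_sum_nonzero:
  fixes s :: "'a \<Rightarrow> int" and f :: "'a \<Rightarrow> nat"
  assumes "finite P" "P \<noteq> {}" "inj_on f P" "\<And>x. x \<in> P \<Longrightarrow> \<bar>s x\<bar> = 1"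
  shows "(\<Sum>x\<in>P. s x * 2 ^ f x) \<noteq> 0"
proof
  assume zero: "(\<Sum>x\<in>P. s x * 2 ^ f x) = 0"
  obtain y where y: "y \<in> P" "\<And>x. x \<in> P \<Longrightarrow> f y \<le> f x"
    using ex_min_if_finite[of "f ` P"] assms(1,2) by (auto simp: not_less)
  have split: "(\<Sum>x\<in>P. s x * 2 ^ f x) = s y * 2 ^ f y + (\<Sum>x\<in>P-{y}. s x * 2 ^ f x)"
    using assms(1) y(1) by (simp add: sum.remove)
  have "(2::int) ^ Suc (f y) dvd (\<Sum>x\<in>P-{y}. s x * 2 ^ f x)"
  proof (rule dvd_sum)
    fix x assume x: "x \<in> P - {y}"
    have "f x \<noteq> f y" using x y(1) assms(3) by (auto dest: inj_onD)
    then have "Suc (f y) \<le> f x" using y(2)[of x] x by auto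
    then show "(2::int) ^ Suc (f y) dvd s x * 2 ^ f x"
      by (intro dvd_mult le_imp_power_dvd)
  qed
  then have "(2::int) ^ Suc (f y) dvd s y * 2 ^ f y"
    using split zero by (metis dvd_0_right dvd_add_left_iff)
  then have "(2::int) ^ f y * 2 dvd 2 ^ f y * s y" by (simp add: mult.commute)
  then have "(2::int) dvd s y" by (subst (asm) dvd_mult_cancel_left) auto
  moreover have "s y = 1 \<or> s y = -1" using assms(4)[OF y(1)] by linarith
  ultimately show False by auto
qed

lemma permutes_less: "\<pi> permutes {0..<n} \<Longrightarrow> i < n \<Longrightarrow> \<pi> i < n" for n :: nat
  using permutes_in_image[of \<pi> "{0..<n}" i] by simp

text \<open>These integers stand in for independent indeterminates: in a product of nonzero entries
  at distinct positions, the binary digits of the exponent of 2 list the positions used.\<close>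

definition generic_entry :: "nat set list \<Rightarrow> nat \<Rightarrow> nat \<Rightarrow> int" where
  "generic_entry G a c = (if c \<in> G ! a then 2 ^ 2 ^ prod_encode (a, c) else 0)"

lemma generic_det_nonzero:
  assumes rho: "inj_on \<rho> {0..<n}" and e: "inj_on e {0..<n}"
    and match: "\<And>l. l < n \<Longrightarrow> e l \<in> G ! \<rho> l"
  shows "det (mat n n (\<lambda>(r, l). generic_entry G (\<rho> r) (e l))) \<noteq> 0" (is "det ?D \<noteq> 0")
proof -
  \<comment> \<open>\<open>P\<close> collects the permutations whose Leibniz term survives.
    \<open>X \<pi>\<close> is the coded set of positions that \<open>\<pi>\<close> uses, so this
    term is a signed \<open>2 ^ set_encode (X \<pi>)\<close>.\<close>
  define P where "P = {\<pi>. \<pi> permutes {0..<n} \<and> (\<forall>i<n. e (\<pi> i) \<in> G ! \<rho> i)}"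
  define X where "X \<pi> = (\<lambda>i. prod_encode (\<rho> i, e (\<pi> i))) ` {0..<n}" for \<pi>
  have fin: "finite {\<pi>. \<pi> permutes {0..<n}}" by (simp add: finite_permutations)
  have "det ?D = (\<Sum>\<pi>\<in>{\<pi>. \<pi> permutes {0..<n}}.
      signof \<pi> * (\<Prod>i = 0..<n. generic_entry G (\<rho> i) (e (\<pi> i))))"
    by (subst det_def'[where n = n]) (auto intro!: sum.cong prod.cong dest: permutes_less)
  also have "\<dots> = (\<Sum>\<pi>\<in>P. signof \<pi> * (\<Prod>i = 0..<n. generic_entry G (\<rho> i) (e (\<pi> i))))"
    by (rule sum.mono_neutral_right[OF fin]) (auto simp: P_def generic_entry_def)
  also have "\<dots> = (\<Sum>\<pi>\<in>P. signof \<pi> * 2 ^ set_encode (X \<pi>))"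
  proof (rule sum.cong[OF refl])
    fix \<pi> assume \<pi>: "\<pi> \<in> P"
    have inj: "inj_on (\<lambda>i. prod_encode (\<rho> i, e (\<pi> i))) {0..<n}"
      using rho by (auto simp: inj_on_def)
    have "(\<Prod>i = 0..<n. generic_entry G (\<rho> i) (e (\<pi> i))) =
        (\<Prod>i = 0..<n. 2 ^ 2 ^ prod_encode (\<rho> i, e (\<pi> i)))"
      using \<pi> by (intro prod.cong) (auto simp: P_def generic_entry_def)
    also have "\<dots> = 2 ^ set_encode (X \<pi>)"
      by (simp add: power_sum set_encode_def X_def sum.reindex[OF inj])
    finally show "signof \<pi> * (\<Prod>i = 0..<n. generic_entry G (\<rho> i) (e (\<pi> i))) =
        signof \<pi> * 2 ^ set_encode (X \<pi>)" by simp
  qed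
  also have "\<dots> \<noteq> 0"
  proof (rule signed_powers_of_two_sum_nonzero)
    show "finite P" using fin by (rule rev_finite_subset) (auto simp: P_def)
    \<comment> \<open>The given matching sits on the diagonal.\<close>
    have "id \<in> P" using match by (auto simp: P_def permutes_id)
    then show "P \<noteq> {}" by auto
    \<comment> \<open>The exponent determines the set of used positions; injectivity of
      \<open>\<rho>\<close> then recovers the row index and injectivity of \<open>e\<close> the
      column index.\<close>
    show "inj_on (\<lambda>\<pi>. set_encode (X \<pi>)) P"
    proof (rule inj_onI)
      fix \<pi> \<pi>' assume pi: "\<pi> \<in> P" "\<pi>' \<in> P" and eq: "set_encode (X \<pi>) = set_encode (X \<pi>')"
      have "X \<pi> = X \<pi>'"
        using eq inj_on_set_encode by (auto simp: X_def dest: inj_onD)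
      have "\<pi> i = \<pi>' i" for i
      proof (cases "i < n")
        case True
        then have "prod_encode (\<rho> i, e (\<pi> i)) \<in> X \<pi>'"
          unfolding \<open>X \<pi> = X \<pi>'\<close>[symmetric] by (auto simp: X_def)
        then obtain i' where i': "i' < n" "\<rho> i = \<rho> i'" "e (\<pi> i) = e (\<pi>' i')"
          by (auto simp: X_def)
        then have "i' = i" using True rho by (auto dest: inj_onD)
        moreover have "\<pi> i < n" "\<pi>' i < n"
          using pi True by (auto simp: P_def dest: permutes_less)
        ultimately show ?thesis using i' e by (auto dest: inj_onD)
      next
        case False
        then show ?thesis using pi by (auto simp: P_def permutes_def)
      qed
      then show "\<pi> = \<pi>'" by auto
    qed
    show "\<bar>signof \<pi>\<bar> = (1::int)" for \<pi> by (simp add: sign_def)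
  qed
  finally show ?thesis .
qed

section \<open>Maximum matchings and vanishing determinants\<close>

definition matching :: "nat set list \<Rightarrow> nat set \<Rightarrow> (nat \<times> nat) set \<Rightarrow> bool" where
  "matching G L S \<longleftrightarrow> S \<subseteq> {(a, c). a < length G \<and> c \<in> L \<and> c \<in> G ! a} \<and>
     inj_on fst S \<and> inj_on snd S"

lemma mcm_matching: "mcm G L = Max {card S | S. matching G L S}"
  by (simp add: mcm_def matching_def)

lemma finite_matchings:
  assumes "finite L"
  shows "finite {card S | S. matching G L S}"
proof -
  have "finite {(a, c). a < length G \<and> c \<in> L \<and> c \<in> G ! a}"
    by (rule finite_subset[of _ "{..<length G} \<times> L"]) (use assms in auto)
  then have "finite {S. matching G L S}"
    by (rule_tac finite_subset[of _ "Pow {(a, c). a < length G \<and> c \<in> L \<and> c \<in> G ! a}"])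
      (auto simp: matching_def)
  then show ?thesis by simp
qed

lemma card_matching_le_mcm: "finite L \<Longrightarrow> matching G L S \<Longrightarrow> card S \<le> mcm G L"
  unfolding mcm_matching by (rule Max_ge) (auto intro: finite_matchings)

lemma maximum_matching:
  assumes "finite L"
  obtains S where "matching G L S" "card S = mcm G L"
proof -
  have "matching G L {}" by (simp add: matching_def)
  then have "mcm G L \<in> {card S | S. matching G L S}"
    unfolding mcm_matching by (intro Max_in finite_matchings assms) auto
  then show ?thesis using that by auto
qed

text \<open>A nonzero Leibniz term would be a matching with \<open>n\<close> edges into columns of
  \<open>L\<close>, more than \<open>mcm\<close> allows.\<close>

lemma det_zero_without_matching:
  assumes L: "finite L" "\<And>l. l < n \<Longrightarrow> e l \<in> L" "mcm G L < n"
    and rho: "inj_on \<rho> {0..<n}" "\<And>r. r < n \<Longrightarrow> \<rho> r < length G"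
    and e: "inj_on e {0..<n}"
  shows "det (mat n n (\<lambda>(r, l). generic_entry G (\<rho> r) (e l))) = 0" (is "det ?D = 0")
proof -
  have "(\<Prod>i = 0..<n. generic_entry G (\<rho> i) (e (\<pi> i))) = 0" if \<pi>: "\<pi> permutes {0..<n}" for \<pi>
  proof (rule ccontr)
    assume "(\<Prod>i = 0..<n. generic_entry G (\<rho> i) (e (\<pi> i))) \<noteq> 0"
    then have one: "\<And>i. i < n \<Longrightarrow> e (\<pi> i) \<in> G ! \<rho> i"
      by (auto simp: generic_entry_def split: if_splits)
    have inj\<pi>: "inj_on (e \<circ> \<pi>) {0..<n}"
      using \<pi> e by (auto intro!: comp_inj_on simp: permutes_image permutes_inj_on)
    let ?S = "(\<lambda>i. (\<rho> i, e (\<pi> i))) ` {0..<n}"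
    have "inj_on fst ?S" using rho(1) by (auto simp: inj_on_def)
    moreover have "inj_on snd ?S" using inj\<pi> by (auto simp: inj_on_def)
    moreover have "(\<rho> i, e (\<pi> i)) \<in> {(a, c). a < length G \<and> c \<in> L \<and> c \<in> G ! a}" if "i < n" for i
      using one[OF that] rho(2)[OF that] L(2)[OF permutes_less[OF \<pi> that]] by simp
    ultimately have "matching G L ?S"
      unfolding matching_def by (meson atLeastLessThan_iff image_subsetI)
    moreover have "card ?S = n" using rho(1) by (subst card_image) (auto simp: inj_on_def)
    ultimately show False using card_matching_le_mcm[OF L(1)] L(3) by fastforce
  qed
  then show ?thesis
    by (subst det_def'[where n = n]) (auto intro!: sum.neutral dest: permutes_less)
qed

text \<open>The coefficients are cofactors along column \<open>i\<close> of a square submatrix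
  carried by a maximum matching, so each combination of entries is again a determinant.\<close>

lemma separating_combination:
  assumes L: "finite L" "i \<notin> L" and mcm: "mcm G (insert i L) = mcm G L + 1"
  shows "\<exists>u d. d \<noteq> 0 \<and> (\<forall>c\<in>insert i L.
    (\<Sum>a<length G. u a * generic_entry G a c) = (if c = i then d else 0))"
proof -
  define n where "n = mcm G L + 1"
  obtain S where S: "matching G (insert i L) S" "card S = n"
    using maximum_matching[of "insert i L" G] L(1) mcm by (auto simp: n_def)
  have "finite S" using S(2) by (auto simp: n_def intro: card_ge_0_finite)
  then obtain f where f: "bij_betw f {0..<n} S" using ex_bij_betw_nat_finite S(2) by blast
  define \<rho> e where "\<rho> = fst \<circ> f" and "e = snd \<circ> f"
  have inj: "inj_on \<rho> {0..<n}" "inj_on e {0..<n}"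
    using f S(1) by (auto simp: \<rho>_def e_def matching_def bij_betw_def intro!: comp_inj_on)
  have entry: "\<rho> l < length G" "e l \<in> insert i L" "e l \<in> G ! \<rho> l" if "l < n" for l
  proof -
    have "f l \<in> S" using f that by (auto simp: bij_betw_def)
    then show "\<rho> l < length G" "e l \<in> insert i L" "e l \<in> G ! \<rho> l"
      using S(1) by (auto simp: \<rho>_def e_def matching_def)
  qed
  \<comment> \<open>A matching avoiding column \<open>i\<close> would lie in \<open>L\<close> and
    have one edge more than \<open>mcm G L\<close>.\<close>
  have "\<exists>j<n. e j = i"
  proof (rule ccontr)
    assume "\<not> (\<exists>j<n. e j = i)"
    then have "e l \<in> L" if "l < n" for l using entry(2)[OF that] that by auto
    moreover have "snd p \<in> e ` {0..<n}" if "p \<in> S" for p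
      using f that by (auto simp: e_def bij_betw_def)
    ultimately have "snd p \<in> L" if "p \<in> S" for p using that by fastforce
    then have "matching G L S" using S(1) by (auto simp: matching_def)
    then show False using card_matching_le_mcm[OF L(1)] S(2) by (fastforce simp: n_def)
  qed
  then obtain j where j: "j < n" "e j = i" by auto
  \<comment> \<open>\<open>D c\<close> is the matched submatrix with the column of \<open>i\<close>
    overwritten by that of \<open>c\<close>; its cofactors along this column do not depend on
    \<open>c\<close>. As \<open>\<rho>\<close> is injective, the sum defining \<open>u\<close> has
    at most one term: it places \<open>v\<close> on the rows used and 0 on the others.\<close>
  define D where "D c = mat n n (\<lambda>(r, l). generic_entry G (\<rho> r) ((e(j := c)) l))" for c
  define v where "v r = cofactor (D i) r j" for r
  define u where "u a = (\<Sum>r | r \<in> {0..<n} \<and> \<rho> r = a. v r)" for a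
  have carrier: "D c \<in> carrier_mat n n" for c by (simp add: D_def)
  have minor: "mat_delete (D c) r j = mat_delete (D i) r j" for c r
    by (rule eq_matI) (auto simp: mat_delete_def D_def)
  then have expand: "det (D c) = (\<Sum>r<n. generic_entry G (\<rho> r) c * v r)" for c
    unfolding laplace_expansion_column[OF carrier j(1), of c] v_def cofactor_def minor[of c]
    using j(1) by (intro sum.cong) (auto simp: D_def)
  have comb: "(\<Sum>a<length G. u a * generic_entry G a c) = det (D c)" for c
  proof -
    have "(\<Sum>a<length G. u a * generic_entry G a c) =
      (\<Sum>a<length G. \<Sum>r | r \<in> {0..<n} \<and> \<rho> r = a. generic_entry G (\<rho> r) c * v r)"
      by (auto simp: u_def sum_distrib_left mult.commute intro!: sum.cong)
    also have "\<dots> = (\<Sum>r\<in>{0..<n}. generic_entry G (\<rho> r) c * v r)"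
      by (rule sum.group) (use entry(1) in auto)
    finally show ?thesis by (simp add: expand atLeast0LessThan)
  qed
  have "det (D c) = 0" if c: "c \<in> L" for c
  proof (cases "c \<in> e ` {0..<n}")
    case True
    then obtain l where l: "l < n" "c = e l" by auto
    then have "l \<noteq> j" using c j L(2) by auto
    then show ?thesis
      using l j(1) by (intro det_identical_columns[OF carrier, of l j]) (auto simp: D_def)
  next
    case False
    \<comment> \<open>Only position \<open>j\<close> held \<open>i\<close>, so after the replacement
      there are \<open>n\<close> distinct columns, all in \<open>L\<close>, while
      \<open>mcm G L\<close> is \<open>n - 1\<close>.\<close>
    have "(e(j := c)) l \<in> L" if "l < n" for l
      using entry(2)[of l] inj(2) j c that by (auto dest: inj_onD)
    moreover have "inj_on (e(j := c)) {0..<n}"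
      using inj(2) False by (auto simp: inj_on_def)
    ultimately show ?thesis unfolding D_def
      using L(1) inj(1) entry(1)
      by (intro det_zero_without_matching[where L = L]) (simp_all add: n_def del: fun_upd_apply)
  qed
  moreover have "det (D i) \<noteq> 0"
    using generic_det_nonzero[OF inj entry(3)] j(2) by (simp add: D_def fun_upd_idem)
  ultimately show ?thesis
    by (intro exI[of _ u] exI[of _ "det (D i)"]) (use L(2) in \<open>auto simp: comb\<close>)
qed

section \<open>UMCD yields a scalar linear code\<close>

text \<open>This is the linear decoding condition of receiver \<open>i\<close>: the combination
  \<open>u\<close> of the transmitted symbols cancels the unknown interfering messages and leaves
  \<open>d\<close> times the wanted one. Columns in the side information are unconstrained. Keeping
  \<open>d\<close> instead of normalising it to 1 keeps everything integral until a prime is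
  chosen.\<close>

definition separates :: "nat set list \<Rightarrow> nat set \<Rightarrow> (nat \<Rightarrow> nat set) \<Rightarrow> nat \<Rightarrow> (nat \<Rightarrow> int) \<Rightarrow> int \<Rightarrow> bool" where
  "separates G M A i u d \<longleftrightarrow> d \<noteq> 0 \<and> (\<forall>c\<in>insert i (Bset M A i).
     (\<Sum>a<length G. u a * generic_entry G a c) = (if c = i then d else 0))"

text \<open>Later rows get coefficient 0, and an entry depends only on its own row and position, so
  appending rows leaves the old entries unchanged.\<close>

lemma separates_append:
  assumes "separates G M A i u d"
  shows "\<exists>u'. separates (G @ G') M A i u' d"
proof -
  let ?u = "\<lambda>a. if a < length G then u a else 0"
  have "(\<Sum>a<length (G @ G'). ?u a * generic_entry (G @ G') a c) =
      (\<Sum>a<length G. u a * generic_entry G a c)" for c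
    by (rule sum.mono_neutral_cong_right) (auto simp: generic_entry_def nth_append)
  then show ?thesis using assms unfolding separates_def by (intro exI[of _ ?u]) simp
qed

text \<open>The new row alone suffices: it is supported on \<open>w\<close> and the side information
  of \<open>w\<close>.\<close>

lemma separates_chosen_receiver:
  "\<exists>u d. separates (G @ [{w} \<union> (A w \<inter> M)]) M A w u d"
proof -
  let ?G = "G @ [{w} \<union> (A w \<inter> M)]"
  let ?u = "\<lambda>a. if a = length G then 1 else 0"
  have "(\<Sum>a<length ?G. ?u a * generic_entry ?G a c) = generic_entry ?G (length G) c" for c
    by simp
  then show ?thesis unfolding separates_def
    by (intro exI[of _ ?u] exI[of _ "generic_entry ?G (length G) w"])
      (auto simp: generic_entry_def Bset_def)
qed

text \<open>\<open>G @ G'\<close> is the final matrix of the execution. A receiver leaves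
  \<open>N\<close> either by being chosen or by passing the \<open>mcm\<close> test; in both cases a
  separating combination exists at that moment and survives all later rows.\<close>

lemma umcd_exec_separates:
  assumes "umcd_exec M A N G k" "finite M"
  shows "\<exists>G'. length (G @ G') = k \<and> (\<forall>i\<in>N. \<exists>u d. separates (G @ G') M A i u d)"
  using assms
proof (induction rule: umcd_exec.induct)
  case (stop G)
  then show ?case by (intro exI[of _ "[]"]) auto
next
  case (step w N G' G N' k)
  from step.IH[OF step.prems] obtain R where R: "length (G' @ R) = k"
    "\<forall>i\<in>N'. \<exists>u d. separates (G' @ R) M A i u d" by blast
  have "\<exists>u d. separates (G' @ R) M A i u d" if i: "i \<in> N" for i
  proof (cases "i \<in> N'")
    case True
    then show ?thesis using R(2) by blast
  next
    case False
    have "\<exists>u d. separates G' M A i u d"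
    proof (cases "i = w")
      case True
      then show ?thesis using separates_chosen_receiver step.hyps(3) by metis
    next
      case w: False
      have "finite (Bset M A i)" "i \<notin> Bset M A i" using step.prems by (auto simp: Bset_def)
      moreover have "mcm G' (insert i (Bset M A i)) = mcm G' (Bset M A i) + 1"
        using False i w step.hyps(4) by auto
      ultimately show ?thesis using separating_combination unfolding separates_def by blast
    qed
    then show ?thesis using separates_append by blast
  qed
  then show ?case using R(1) step.hyps(3)
    by (intro exI[of _ "[{w} \<union> (A w \<inter> M)] @ R"]) auto
qed

text \<open>Each round removes at least the chosen \<open>w\<close>. This later ensures that the
  infimum over fractional covers is taken over a nonempty set.\<close>

lemma umcd_exec_exists:
  assumes "finite N"
  shows "\<exists>k. umcd_exec M A N G k"
  using assms
proof (induction "card N" arbitrary: N G rule: less_induct)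
  case less
  show ?case
  proof (cases "N = {}")
    case True
    then show ?thesis using umcd_exec.stop by blast
  next
    case False
    obtain w where w: "w \<in> N" "\<forall>v\<in>N. card (A w \<inter> M) \<le> card (A v \<inter> M)"
      using ex_has_least_nat[of "\<lambda>v. v \<in> N" _ "\<lambda>v. card (A v \<inter> M)"] False by blast
    define G' where "G' = G @ [{w} \<union> (A w \<inter> M)]"
    define N' where "N' = {i \<in> N - {w}. mcm G' ({i} \<union> Bset M A i) \<noteq> mcm G' (Bset M A i) + 1}"
    have sub: "N' \<subset> N" using w(1) by (auto simp: N'_def)
    then obtain k where "umcd_exec M A N' G' k"
      using less.hyps[of N' G'] less.prems psubset_card_mono finite_subset by (metis psubsetE)
    then show ?thesis using umcd_exec.step[OF w G'_def N'_def] by blast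
  qed
qed

text \<open>Decodability is expressed without decoders: equal codewords and equal side information
  force equal wanted symbols. Only the symbols \<open>a < k\<close> count as transmitted.\<close>

definition scalar_code ::
  "nat \<Rightarrow> nat set \<Rightarrow> (nat \<Rightarrow> nat set) \<Rightarrow> nat \<Rightarrow> ((nat \<Rightarrow> nat) \<Rightarrow> nat \<Rightarrow> nat) \<Rightarrow> bool" where
  "scalar_code q M A k f \<longleftrightarrow> (\<forall>y a. f y a < q) \<and>
     (\<forall>i\<in>M. \<forall>y y'. (\<forall>c. y c < q) \<and> (\<forall>c. y' c < q) \<and> (\<forall>a<k. f y a = f y' a) \<and>
        (\<forall>c\<in>A i \<inter> M. y c = y' c) \<longrightarrow> y i = y' i)"

text \<open>By linearity, consider the difference \<open>z\<close> of two inputs that receiver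
  \<open>i\<close> cannot tell apart. The separating combination gives that \<open>p\<close> divides
  \<open>d i * z i\<close>, hence \<open>z i\<close>, whose absolute value is below
  \<open>p\<close>.\<close>

lemma scalar_code_of_separates:
  assumes M: "finite M" and p: "prime p"
    and sep: "\<And>i. i \<in> M \<Longrightarrow> \<exists>u. separates G M A i u (d i)"
    and d: "\<And>i. i \<in> M \<Longrightarrow> \<not> int p dvd d i"
  shows "\<exists>f. scalar_code p M A (length G) f"
proof -
  define F where "F y a = (\<Sum>c\<in>M. generic_entry G a c * int (y c))" for y :: "nat \<Rightarrow> nat" and a
  define f where "f y a = nat (F y a mod int p)" for y a
  have p0: "int p > 0" using p prime_gt_0_nat by simp
  have "y i = y' i"
    if i: "i \<in> M" and y: "\<And>c. y c < p" "\<And>c. y' c < p"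
      and eq: "\<And>a. a < length G \<Longrightarrow> f y a = f y' a" and known: "\<forall>c\<in>A i \<inter> M. y c = y' c"
    for i y y'
  proof (rule ccontr)
    assume ne: "y i \<noteq> y' i"
    then have iA: "i \<notin> A i" using i known by auto
    obtain u where u: "separates G M A i u (d i)" using sep[OF i] by blast
    define z where "z c = int (y c) - int (y' c)" for c
    have dvd: "int p dvd (\<Sum>c\<in>M. generic_entry G a c * z c)" if "a < length G" for a
    proof -
      have "F y a mod int p = F y' a mod int p"
        using eq[OF that] p0 by (simp add: f_def nat_eq_iff)
      then have "int p dvd F y a - F y' a" by (simp add: mod_eq_dvd_iff)
      then show ?thesis by (simp add: F_def z_def right_diff_distrib sum_subtractf)
    qed
    \<comment> \<open>A column other than \<open>i\<close> is either known, so \<open>z c\<close> is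
      0, or lies in \<open>Bset M A i\<close>, where the combination vanishes.\<close>
    have zero: "(\<Sum>a<length G. u a * generic_entry G a c) * z c = 0" if "c \<in> M - {i}" for c
      using that u known by (cases "c \<in> A i") (auto simp: separates_def Bset_def z_def)
    have "(\<Sum>a<length G. u a * (\<Sum>c\<in>M. generic_entry G a c * z c)) =
        (\<Sum>c\<in>M. (\<Sum>a<length G. u a * generic_entry G a c) * z c)"
      by (simp add: sum_distrib_left sum_distrib_right mult.assoc sum.swap[of _ M])
    also have "\<dots> = (\<Sum>a<length G. u a * generic_entry G a i) * z i"
      using zero M i by (subst sum.remove[OF M i]) (simp add: sum.neutral)
    also have "\<dots> = d i * z i" using u by (simp add: separates_def)
    finally have "int p dvd d i * z i"
      using dvd by (metis (no_types, lifting) dvd_mult dvd_sum lessThan_iff)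
    then have "int p dvd z i"
      using d[OF i] p by (simp add: prime_dvd_mult_iff)
    moreover have "\<bar>z i\<bar> < int p" "z i \<noteq> 0" using y[of i] ne by (auto simp: z_def)
    ultimately show False using zdvd_imp_le[of "int p" "\<bar>z i\<bar>"] by auto
  qed
  moreover have "f y a < p" for y a using p0 by (simp add: f_def nat_less_iff)
  ultimately show ?thesis unfolding scalar_code_def by (intro exI[of _ f]) blast
qed

lemma umcd_scalar_code:
  assumes "umcd_exec M A M [] k" "finite M"
  shows "\<exists>b. \<forall>p. prime p \<and> p > b \<longrightarrow> (\<exists>f. scalar_code p M A k f)"
proof -
  obtain G where G: "length G = k" "\<forall>i\<in>M. \<exists>u d. separates G M A i u d"
    using umcd_exec_separates[OF assms] by auto
  then obtain d where d: "\<And>i. i \<in> M \<Longrightarrow> \<exists>u. separates G M A i u (d i)" by metis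
  \<comment> \<open>A prime above this sum exceeds every \<open>\<bar>d i\<bar>\<close> and so
    divides none of the nonzero \<open>d i\<close>.\<close>
  let ?b = "nat (\<Sum>i\<in>M. \<bar>d i\<bar>)"
  have "\<exists>f. scalar_code p M A k f" if p: "prime p" "p > ?b" for p
  proof -
    have "\<not> int p dvd d i" if i: "i \<in> M" for i
    proof
      assume "int p dvd d i"
      moreover have "d i \<noteq> 0" using d[OF i] by (auto simp: separates_def)
      ultimately have "int p \<le> \<bar>d i\<bar>" using zdvd_imp_le[of "int p" "\<bar>d i\<bar>"] by auto
      also have "\<dots> \<le> (\<Sum>i\<in>M. \<bar>d i\<bar>)" using assms(2) i by (intro member_le_sum) auto
      finally show False using p(2) by linarith
    qed
    then show ?thesis using scalar_code_of_separates[OF assms(2) p(1) d] G(1) by auto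
  qed
  then show ?thesis by blast
qed

section \<open>Time sharing\<close>

text \<open>The decoder picks any message tuple consistent with the codeword and the side
  information; all of them agree on the wanted message.\<close>

lemma index_code_if_determined:
  assumes "\<And>x. x \<in> msgs q m t \<Longrightarrow> \<phi> x \<in> vecs q r"
    and "\<And>x x' i. \<lbrakk>x \<in> msgs q m t; x' \<in> msgs q m t; i < m; \<phi> x = \<phi> x';
           \<And>c. c \<in> A i \<Longrightarrow> x c = x' c\<rbrakk> \<Longrightarrow> x i = x' i"
  shows "\<exists>\<psi>. is_index_code q m A t r \<phi> \<psi>"
proof -
  define \<psi> where "\<psi> i y s = (SOME x. x \<in> msgs q m t \<and> \<phi> x = y \<and> side_info A i x = s) i" for i y s
  have "\<psi> i (\<phi> x) (side_info A i x) = x i" if x: "x \<in> msgs q m t" and i: "i < m" for x i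
  proof -
    let ?Q = "\<lambda>x'. x' \<in> msgs q m t \<and> \<phi> x' = \<phi> x \<and> side_info A i x' = side_info A i x"
    have Q: "?Q (SOME x'. ?Q x')" by (rule someI[of ?Q x]) (use x in auto)
    then have "(SOME x'. ?Q x') c = x c" if "c \<in> A i" for c
    proof -
      have "side_info A i (SOME x'. ?Q x') c = side_info A i x c" using Q by simp
      then show ?thesis using that by (simp add: side_info_def)
    qed
    then show ?thesis unfolding \<psi>_def using assms(2)[OF _ x i, of "SOME x'. ?Q x'"] Q by blast
  qed
  then show ?thesis using assms(1) unfolding is_index_code_def by blast
qed

text \<open>The \<open>j\<close>-th scalar code is used \<open>N j\<close> times. The
  \<open>t\<close> symbols of each message go into distinct uses of codes serving its receiver, and
  \<open>cover\<close> says that there are enough of them.\<close>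

lemma time_sharing_code:
  fixes f :: "nat \<Rightarrow> (nat \<Rightarrow> nat) \<Rightarrow> nat \<Rightarrow> nat"
  assumes q: "q > 0"
    and code: "\<And>j. j < n \<Longrightarrow> scalar_code q (Ms j) A (k j) (f j)"
    and cover: "\<And>i. i < m \<Longrightarrow> t \<le> (\<Sum>j | j < n \<and> i \<in> Ms j. N j)"
  shows "\<exists>\<phi> \<psi>. is_index_code q m A t (\<Sum>j<n. N j * k j) \<phi> \<psi>"
proof -
  define r where "r = (\<Sum>j<n. N j * k j)"
  \<comment> \<open>A triple in \<open>T\<close> is a code, one of its uses and a symbol of that
    use; \<open>b\<close> numbers these as coordinates of the codeword.\<close>
  define T where "T = (SIGMA j:{..<n}. {..<N j} \<times> {..<k j})"
  have T: "finite T" "card T = r" by (auto simp: T_def r_def card_SigmaI)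
  then obtain b where b: "bij_betw b {0..<r} T" using ex_bij_betw_nat_finite by blast
  define Slots where "Slots i = (SIGMA j:{j. j < n \<and> i \<in> Ms j}. {..<N j})" for i
  have "\<exists>g. inj_on g {..<t} \<and> g ` {..<t} \<subseteq> Slots i" if "i < m" for i
  proof -
    have "finite (Slots i)" "card (Slots i) = (\<Sum>j | j < n \<and> i \<in> Ms j. N j)"
      by (auto simp: Slots_def card_SigmaI)
    then show ?thesis using card_le_inj[of "{..<t}" "Slots i"] cover[OF that] by auto
  qed
  then obtain g where g: "\<And>i. i < m \<Longrightarrow> inj_on (g i) {..<t} \<and> g i ` {..<t} \<subseteq> Slots i" by metis
  \<comment> \<open>\<open>X x js\<close> is the scalar input in slot \<open>js\<close>: message
    \<open>c\<close> contributes the symbol that \<open>g c\<close> assigns to this slot, and the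
    filler 0 if there is none.\<close>
  define X where "X x js c = (if c < m \<and> js \<in> g c ` {..<t} then x c (the_inv_into {..<t} (g c) js) else 0)"
    for x :: "nat \<Rightarrow> nat \<Rightarrow> nat" and js c
  define \<phi> where "\<phi> x l = (if l < r then case b l of (j, s, a) \<Rightarrow> f j (X x (j, s)) a else 0)" for x l
  have X_less: "X x js c < q" if x: "x \<in> msgs q m t" for x js c
  proof (cases "c < m \<and> js \<in> g c ` {..<t}")
    case True
    then have "the_inv_into {..<t} (g c) js \<in> {..<t}"
      using g by (intro the_inv_into_into) auto
    then show ?thesis using True x by (auto simp: X_def msgs_def vecs_def)
  qed (use q in \<open>auto simp: X_def\<close>)
  have "\<exists>\<psi>. is_index_code q m A t r \<phi> \<psi>"
  proof (rule index_code_if_determined)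
    fix x assume "x \<in> msgs q m t"
    have "b l \<in> T" if "l < r" for l using b that by (auto simp: bij_betw_def)
    then show "\<phi> x \<in> vecs q r"
      using code by (fastforce simp: vecs_def \<phi>_def T_def scalar_code_def split: prod.splits)
  next
    fix x x' i
    assume x: "x \<in> msgs q m t" "x' \<in> msgs q m t" and i: "i < m" and eq: "\<phi> x = \<phi> x'"
      and known: "\<And>c. c \<in> A i \<Longrightarrow> x c = x' c"
    show "x i = x' i"
    proof
      fix l
      show "x i l = x' i l"
      proof (cases "l < t")
        case False
        then show ?thesis using x i by (auto simp: msgs_def vecs_def)
      next
        case True
        obtain j s where js: "g i l = (j, s)" by fastforce
        then have "(j, s) \<in> Slots i" using g[OF i] True by force
        then have slot: "j < n" "i \<in> Ms j" "s < N j" by (auto simp: Slots_def)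
        have "f j (X x (j, s)) a = f j (X x' (j, s)) a" if "a < k j" for a
        proof -
          have "(j, s, a) \<in> T" using slot that by (auto simp: T_def)
          then obtain l' where "l' < r" "b l' = (j, s, a)" using b by (force simp: bij_betw_def)
          then show ?thesis using fun_cong[OF eq, of l'] by (simp add: \<phi>_def)
        qed
        \<comment> \<open>The slot assignment is independent of the messages, so whoever knows the
          whole message \<open>c\<close> knows its contribution to every slot.\<close>
        moreover have "X x (j, s) c = X x' (j, s) c" if "c \<in> A i" for c
          using known[OF that] by (simp add: X_def)
        ultimately have "X x (j, s) i = X x' (j, s) i"
          using code[OF slot(1)] slot(2) X_less[OF x(1)] X_less[OF x(2)]
          unfolding scalar_code_def by blast
        moreover have "X y (j, s) i = y i l" for y
          using g[OF i] i True js[symmetric] by (simp add: X_def the_inv_into_f_f)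
        ultimately show ?thesis by simp
      qed
    qed
  qed
  then show ?thesis unfolding r_def by blast
qed

section \<open>From codes to rates, and the limit of long messages\<close>

lemma beta_le:
  assumes "is_prime_power q" "t > 0" "is_index_code q m A t r \<phi> \<psi>"
  shows "beta m A \<le> real r / real t"
  unfolding beta_def
  by (rule cInf_lower) (use assms in \<open>blast, auto intro!: bdd_belowI[of _ 0]\<close>)

text \<open>Rounding the number of uses up costs at most one extra use per code, which adds at most
  \<open>K / real t\<close> to the rate and vanishes in the limit.\<close>

lemma beta_le_fractional_cover:
  fixes n :: nat
  assumes Ms: "\<And>j. j < n \<Longrightarrow> finite (Ms j)" "\<And>j. j < n \<Longrightarrow> umcd_exec (Ms j) A (Ms j) [] (k j)"
    and \<gamma>: "\<And>j. j < n \<Longrightarrow> 0 \<le> \<gamma> j"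
    and cover: "\<And>i. i < m \<Longrightarrow> (\<Sum>j | j < n \<and> i \<in> Ms j. \<gamma> j) \<ge> 1"
  shows "beta m A \<le> (\<Sum>j<n. \<gamma> j * real (k j))"
proof -
  define V K where "V = (\<Sum>j<n. \<gamma> j * real (k j))" and "K = (\<Sum>j<n. real (k j))"
  obtain b where b: "\<And>j p. j < n \<Longrightarrow> prime p \<Longrightarrow> p > b j \<Longrightarrow> \<exists>f. scalar_code p (Ms j) A (k j) f"
    using umcd_scalar_code[OF Ms(2,1)] by metis
  \<comment> \<open>All codes must share one alphabet; exceeding the sum of the thresholds exceeds
    each of them. The choice does not depend on \<open>t\<close>.\<close>
  obtain p :: nat where p: "prime p" "p > (\<Sum>j<n. b j)" using bigger_prime by blast
  have "b j < p" if "j < n" for j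
    using p(2) that member_le_sum[of j "{..<n}" b] by simp
  then have "\<forall>j. \<exists>f. j < n \<longrightarrow> scalar_code p (Ms j) A (k j) f" using b p(1) by blast
  then obtain f where f: "\<And>j. j < n \<Longrightarrow> scalar_code p (Ms j) A (k j) (f j)"
    by (auto dest!: choice simp del: all_simps ex_simps)
  have bound: "beta m A \<le> V + K / real t" if t: "t > 0" for t :: nat
  proof -
    define N where "N j = nat \<lceil>\<gamma> j * real t\<rceil>" for j
    have N: "\<gamma> j * real t \<le> real (N j)" "real (N j) \<le> \<gamma> j * real t + 1" if "j < n" for j
      using \<gamma>[OF that] by (auto simp: N_def intro: real_nat_ceiling_ge)
    have "t \<le> (\<Sum>j | j < n \<and> i \<in> Ms j. N j)" if i: "i < m" for i
    proof -
      have "real t \<le> (\<Sum>j | j < n \<and> i \<in> Ms j. \<gamma> j) * real t"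
        using cover[OF i] by (simp add: mult_le_cancel_right1)
      also have "\<dots> \<le> (\<Sum>j | j < n \<and> i \<in> Ms j. real (N j))"
        unfolding sum_distrib_right by (rule sum_mono) (use N in auto)
      finally show ?thesis by (simp flip: of_nat_sum)
    qed
    with time_sharing_code[of p n Ms A k f m t N, OF prime_gt_0_nat[OF p(1)] f]
    obtain \<phi> \<psi> where "is_index_code p m A t (\<Sum>j<n. N j * k j) \<phi> \<psi>" by blast
    moreover have "is_prime_power p"
      unfolding is_prime_power_def using p(1) by (intro exI[of _ p] exI[of _ 1]) auto
    ultimately have "beta m A \<le> real (\<Sum>j<n. N j * k j) / real t" using beta_le t by blast
    \<comment> \<open>This bounds the numerator; monotonicity of division by \<open>t\<close> is
      supplied at the end of the chain.\<close>
    also have "real (\<Sum>j<n. N j * k j) \<le> (\<Sum>j<n. (\<gamma> j * real t + 1) * real (k j))"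
      unfolding of_nat_sum of_nat_mult by (intro sum_mono mult_right_mono) (use N in auto)
    also have "\<dots> = V * real t + K"
      by (simp add: V_def K_def sum_distrib_left sum_distrib_right algebra_simps sum.distrib)
    finally show ?thesis using t by (simp add: field_simps divide_right_mono)
  qed
  have "(\<lambda>t. V + K / real t) \<longlonglongrightarrow> V + 0" by (intro tendsto_intros lim_const_over_n)
  then have "beta m A \<le> V + 0"
    by (rule tendsto_lowerbound) (use bound in \<open>auto intro: eventually_sequentiallyI[of 1]\<close>)
  then show ?thesis by (simp add: V_def)
qed

theorem theorem7:
  fixes m :: nat and A :: "nat \<Rightarrow> nat set"
  assumes "\<forall>i<m. A i \<subseteq> {..<m} - {i}"
  shows "beta m A \<le> beta_FP_UMCD m A"
  unfolding beta_FP_UMCD_def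
proof (rule cInf_greatest, goal_cases)
  \<comment> \<open>The single set of all receivers with weight 1 is a cover, so the infimum is over
    a nonempty set.\<close>
  case 1
  obtain k where k: "umcd_exec {..<m} A {..<m} [] k" using umcd_exec_exists by blast
  have "{j. j < (1::nat) \<and> i \<in> {..<m}} = {0}" if "i < m" for i using that by auto
  with k show ?case
    by (auto intro!: exI[of _ "1::nat"] exI[of _ "\<lambda>_::nat. {..<m}"]
      exI[of _ "\<lambda>_::nat. 1::real"] exI[of _ "\<lambda>_::nat. k"])
next
  case (2 v)
  then obtain n :: nat and Ms \<gamma> k where v: "v = (\<Sum>j<n. \<gamma> j * real (k j))"
    and *: "\<forall>j<n. Ms j \<subseteq> {..<m} \<and> 0 \<le> \<gamma> j \<and> \<gamma> j \<le> 1 \<and> umcd_exec (Ms j) A (Ms j) [] (k j)"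
    and cover: "\<forall>i<m. (\<Sum>j | j < n \<and> i \<in> Ms j. \<gamma> j) \<ge> 1"
    by blast
  have "finite (Ms j)" if "j < n" for j
    using * that finite_subset[OF _ finite_lessThan] by blast
  then show ?case unfolding v using * cover by (intro beta_le_fractional_cover[of n Ms]) auto
qed

end
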